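(* There exist universal constants $0<c\le C<\infty$ such that for all $n\in\mathbb{N}$ and all $a_{i,j}\in\mathbb{R}$, $1\le i<j\le n$, setting $$ Q:=\max\Big\{\sum_{i=1}^{n-1}\Big(\sum_{j=i+1}^n a_{i,j}^2\Big)^{1/2},\ \sum_{j=2}^n\Big(\sum_{i=1}^{j-1} a_{i,j}^2\Big)^{1/2}\Big\}, $$ both of the quantities $$ \mathsf{E}_\theta\Bigl\|\sum_{i=1}^n\sum_{j=i+1}^n \theta_{i,j}a_{i,j}\,r_i r_j\Bigr\|_{L_\infty([0,1])} \quad\text{and}\quad \min_{\theta_{i,j}=\pm 1}\Big\|\sum_{i=1}^n\sum_{j=i+1}^n \theta_{i,j}a_{i,j}\,r_i r_j\Big\|_{L_\infty([0,1])} $$ lie between $cQ$ and $CQ$.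
   Context: The Rademacher functions are $r_i(t)=(-1)^{[2^i t]}$, $t\in[0,1]$, $i=1,2,\dots$, where $[x]$ is the integer part of $x$; $r_ir_j$ is the pointwise product on $[0,1]$. $\mathsf{E}_\theta$ denotes the expectation (uniform average) over all arrangements of signs $\theta_{i,j}=\pm1$, $1\le i<j\le n$. *)

theory Defs
  imports "HOL-Probability.Probability"
begin

definition rademacher :: "nat \<Rightarrow> real \<Rightarrow> real" where
  "rademacher i t = (-1) powi \<lfloor>2 ^ i * t\<rfloor>"

text \<open>The value of esssup is extended real; it is finite for the bounded measurable functions
  considered here (see \<open>ereal_Linf_norm\<close> and \<open>ereal_Linf_norm_chaos\<close>), so that no default
  value of \<^const>\<open>real_of_ereal\<close> is involved.\<close>

definition Linf_norm :: "(real \<Rightarrow> real) \<Rightarrow> real" where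
  "Linf_norm f = real_of_ereal (esssup (lebesgue_on {0..1}) (\<lambda>t. ereal \<bar>f t\<bar>))"

definition index_pairs :: "nat \<Rightarrow> (nat \<times> nat) set" where
  "index_pairs n = {(i, j). 1 \<le> i \<and> i < j \<and> j \<le> n}"

definition sign_arrangements :: "nat \<Rightarrow> (nat \<times> nat \<Rightarrow> real) set" where
  "sign_arrangements n = index_pairs n \<rightarrow>\<^sub>E {-1, 1}"

definition signed_chaos ::
    "nat \<Rightarrow> (nat \<Rightarrow> nat \<Rightarrow> real) \<Rightarrow> (nat \<times> nat \<Rightarrow> real) \<Rightarrow> real \<Rightarrow> real" where
  "signed_chaos n a \<theta> t =
     (\<Sum>i=1..n. \<Sum>j=i+1..n. \<theta> (i, j) * a i j * (rademacher i t * rademacher j t))"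

definition expected_norm :: "nat \<Rightarrow> (nat \<Rightarrow> nat \<Rightarrow> real) \<Rightarrow> real" where
  "expected_norm n a =
     measure_pmf.expectation (pmf_of_set (sign_arrangements n)) (\<lambda>\<theta>. Linf_norm (signed_chaos n a \<theta>))"

definition min_norm :: "nat \<Rightarrow> (nat \<Rightarrow> nat \<Rightarrow> real) \<Rightarrow> real" where
  "min_norm n a = Min ((\<lambda>\<theta>. Linf_norm (signed_chaos n a \<theta>)) ` sign_arrangements n)"

definition max_mixed_norm :: "nat \<Rightarrow> (nat \<Rightarrow> nat \<Rightarrow> real) \<Rightarrow> real" where
  "max_mixed_norm n a =
     max (\<Sum>i=1..n-1. sqrt (\<Sum>j=i+1..n. (a i j)\<^sup>2))
         (\<Sum>j=2..n. sqrt (\<Sum>i=1..j-1. (a i j)\<^sup>2))"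

lemma finite_sign_arrangements: "finite (sign_arrangements n)"
proof -
  have "index_pairs n \<subseteq> {..n} \<times> {..n}"
    by (auto simp: index_pairs_def)
  then have "finite (index_pairs n)"
    by (rule finite_subset) simp
  then show ?thesis
    unfolding sign_arrangements_def by (intro finite_PiE) auto
qed

lemma sign_arrangements_nonempty: "sign_arrangements n \<noteq> {}"
  by (simp add: sign_arrangements_def PiE_eq_empty_iff)

lemma expected_norm_average:
  "expected_norm n a =
     (\<Sum>\<theta>\<in>sign_arrangements n. Linf_norm (signed_chaos n a \<theta>)) / card (sign_arrangements n)"
  unfolding expected_norm_def
  by (rule integral_pmf_of_set[OF sign_arrangements_nonempty finite_sign_arrangements])

lemma ereal_Linf_norm:
  assumes "f \<in> borel_measurable (lebesgue_on {0..1})" and "\<And>t. \<bar>f t\<bar> \<le> B"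
  shows "ereal (Linf_norm f) = esssup (lebesgue_on {0..1}) (\<lambda>t. ereal \<bar>f t\<bar>)"
proof -
  let ?M = "lebesgue_on {0..1::real}" and ?s = "esssup (lebesgue_on {0..1}) (\<lambda>t. ereal \<bar>f t\<bar>)"
  have meas: "(\<lambda>t. ereal \<bar>f t\<bar>) \<in> borel_measurable ?M"
    using assms(1) by measurable
  have "?s \<le> ereal B"
    by (rule esssup_I[OF meas]) (simp add: assms(2))
  moreover have "0 \<le> ?s"
  proof -
    have "emeasure ?M (space ?M) \<noteq> 0"
      by (simp add: emeasure_restrict_space)
    then have "esssup ?M (\<lambda>_. 0::ereal) = 0"
      by (rule esssup_const)
    moreover have "esssup ?M (\<lambda>_. 0::ereal) \<le> ?s"
      by (rule esssup_mono) (simp_all add: zero_ereal_def)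
    ultimately show ?thesis by simp
  qed
  ultimately have "\<bar>?s\<bar> \<noteq> \<infinity>"
    by (metis abs_ereal_ge0 ereal_infty_less_eq(1) ereal_less_eq(1) PInfty_neq_ereal(1) ereal_infty_less_eq2(1))
  then show ?thesis
    unfolding Linf_norm_def by (rule ereal_real')
qed

lemma abs_rademacher: "\<bar>rademacher i t\<bar> = 1"
  by (simp add: rademacher_def power_int_abs)

lemma rademacher_measurable [measurable]: "rademacher i \<in> borel_measurable borel"
proof -
  have "(\<lambda>t::real. (\<lambda>k::int. (-1::real) powi k) \<lfloor>2 ^ i * t\<rfloor>) \<in> borel_measurable borel"
    by measurable
  then show ?thesis
    unfolding rademacher_def by simp
qed

lemma ereal_Linf_norm_chaos:
  "ereal (Linf_norm (signed_chaos n a \<theta>)) =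
     esssup (lebesgue_on {0..1}) (\<lambda>t. ereal \<bar>signed_chaos n a \<theta> t\<bar>)"
proof (rule ereal_Linf_norm)
  have "signed_chaos n a \<theta> \<in> borel_measurable borel"
    unfolding signed_chaos_def by measurable
  then show "signed_chaos n a \<theta> \<in> borel_measurable (lebesgue_on {0..1})"
    by (intro measurable_restrict_space1) (simp add: measurable_completion)
next
  fix t
  have "\<bar>signed_chaos n a \<theta> t\<bar> \<le>
      (\<Sum>i=1..n. \<Sum>j=i+1..n. \<bar>\<theta> (i, j) * a i j * (rademacher i t * rademacher j t)\<bar>)"
    unfolding signed_chaos_def by (rule order_trans[OF sum_abs]) (intro sum_mono sum_abs)
  then show "\<bar>signed_chaos n a \<theta> t\<bar> \<le> (\<Sum>i=1..n. \<Sum>j=i+1..n. \<bar>\<theta> (i, j) * a i j\<bar>)"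
    by (simp add: abs_mult abs_rademacher)
qed

end

theory Submission
  imports Defs
begin

text \<open>
  On a dyadic interval of length \<open>2\<^sup>-\<^sup>n\<close> the first \<open>n\<close> Rademacher functions are constant, and every
  pattern of signs occurs on one of these intervals. So the norm of a chaos in
  \<open>L\<^sub>\<infinity>([0,1])\<close> is the maximum of \<open>\<bar>\<Sum> \<theta>\<^sub>i\<^sub>j a\<^sub>i\<^sub>j s\<^sub>i s\<^sub>j\<bar>\<close> over all \<open>s \<in> {-1, 1}\<^sup>n\<close>, and the theorem
  concerns quadratic forms on the cube. Make the coefficients symmetric with zero diagonal and let
  \<open>W\<^sub>i\<close> be the Euclidean norm of row \<open>i\<close>. Row \<open>i\<close> consists of the entries \<open>a\<^sub>i\<^sub>j\<close> with \<open>j > i\<close> and of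
  the entries \<open>a\<^sub>j\<^sub>i\<close> with \<open>j < i\<close>, whence \<open>Q \<le> \<Sum> W\<^sub>i \<le> 2 Q\<close>.

  Lower bound, for every choice of \<open>\<theta>\<close>. If \<open>\<bar>s\<^sup>T B s\<bar> \<le> K\<close> for all sign vectors, then the same bound holds
  for every principal minor of \<open>B\<close>, by averaging over the deleted signs; and for two sign vectors,
  \<open>s\<^sup>T B t\<close> is the difference of the forms on the minors where \<open>s\<close> and \<open>t\<close> agree and differ, because the
  cross terms cancel by symmetry. Hence \<open>\<bar>s\<^sup>T B t\<bar> \<le> 2 K\<close> (\<open>abs_bilinear_le\<close>). The best \<open>s\<close> for a given
  \<open>t\<close> produces \<open>\<Sum>\<^sub>i \<bar>\<Sum>\<^sub>j B\<^sub>i\<^sub>j t\<^sub>j\<bar>\<close>, whose average over \<open>t\<close> is at least \<open>\<Sum> W\<^sub>i / 2\<close> by Khintchine's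
  inequality. So \<open>\<Sum> W\<^sub>i \<le> 4 K\<close> (\<open>sum_row_norm_le\<close>), with no reference to the signs \<open>\<theta>\<close>.

  Upper bound, for the mean over \<open>\<theta>\<close>. A single union bound over all \<open>2\<^sup>n\<close> sign vectors loses too much when
  the \<open>W\<^sub>i\<close> have different sizes. Instead let \<open>S\<^sub>d = {i. W\<^sub>i > d}\<close> and cut the pairs into blocks: the pairs
  inside \<open>S\<^bsub>d/2\<^esub>\<close> that do not lie inside \<open>S\<^sub>d\<close>, for \<open>d\<close> in a geometric sequence. The sum over such a
  block depends on only \<open>M = card S\<^bsub>d/2\<^esub>\<close> signs, and its variance is at most \<open>2 M d\<^sup>2\<close> because each of its
  pairs contains an index with \<open>W\<^sub>i \<le> d\<close>. The maximal inequality for sub-Gaussian sums therefore bounds the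
  mean of the maximum by \<open>3 M d\<close> (\<open>dominating_block\<close>). An index \<open>i\<close> is counted in \<open>M\<close> only
  while \<open>d/2 < W\<^sub>i\<close>, so the geometric series over the scales sums to a multiple of \<open>\<Sum> W\<^sub>i\<close>
  (\<open>chaos_on_dominated\<close>).

  The minimum over \<open>\<theta>\<close> is at most the mean over \<open>\<theta>\<close>, so these two bounds give all four inequalities, with
  \<open>c = 1/8\<close> and \<open>C = 24\<close>.
\<close>

section \<open>Averages over independent signs\<close>

text \<open>Hoeffding's lemma for a fair coin: with weight \<open>1/2\<close> and step \<open>2 x\<close>, its logarithmic moment
  generating function is \<open>ln (cosh x)\<close>.\<close>

lemma cosh_le_exp_half_square: "cosh (x::real) \<le> exp (x\<^sup>2 / 2)"
proof -
  have *: "cosh y \<le> exp (y\<^sup>2 / 2)" if "y \<ge> 0" for y :: real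
  proof -
    have pos: "1 + (1/2) * (exp (2 * y) - 1) > (0::real)"
      by (simp add: field_simps add_pos_pos)
    have "cosh y = exp (- y) * (1 + (1/2) * (exp (2 * y) - 1))"
      by (simp add: cosh_field_def field_simps flip: exp_add)
    then have "ln (cosh y) = ln (exp (- y) * (1 + (1/2) * (exp (2 * y) - 1)))"
      by (rule arg_cong)
    also have "\<dots> = - y + ln (1 + (1/2) * (exp (2 * y) - 1))"
      using pos by (subst ln_mult_pos) auto
    also have "\<dots> \<le> y\<^sup>2 / 2"
      using Hoeffdings_lemma_aux[of "2 * y" "1/2"] that by (simp add: power2_eq_square)
    finally show ?thesis
      using cosh_real_pos[of y] by (metis exp_le_cancel_iff exp_ln)
  qed
  show ?thesis
    using *[of "\<bar>x\<bar>"] by simp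
qed

abbreviation signs :: "'i set \<Rightarrow> ('i \<Rightarrow> real) set" where
  "signs A \<equiv> A \<rightarrow>\<^sub>E {-1, 1}"

definition sign_mean :: "'i set \<Rightarrow> (('i \<Rightarrow> real) \<Rightarrow> real) \<Rightarrow> real" where
  "sign_mean A f = (\<Sum>\<theta>\<in>signs A. f \<theta>) / 2 ^ card A"

lemma finite_signs: "finite A \<Longrightarrow> finite (signs A)"
  by (intro finite_PiE) auto

lemma card_signs: "finite A \<Longrightarrow> card (signs A) = 2 ^ card A"
  by (simp add: card_PiE numeral_2_eq_2)

lemma signs_nonempty: "signs A \<noteq> {}"
  by (simp add: PiE_eq_empty_iff)

lemma abs_signs_eq_1: "\<theta> \<in> signs A \<Longrightarrow> i \<in> A \<Longrightarrow> \<bar>\<theta> i\<bar> = 1"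
  by (force dest: PiE_mem)

lemma sign_mean_empty: "sign_mean {} f = f (\<lambda>_. undefined)"
  by (simp add: sign_mean_def)

text \<open>Conditioning on all signs but one; every moment computation below is an induction along
  this identity.\<close>

lemma sign_mean_insert:
  assumes "finite A" "a \<notin> A"
  shows "sign_mean (insert a A) f = sign_mean A (\<lambda>\<theta>. (f (\<theta>(a := 1)) + f (\<theta>(a := -1))) / 2)"
proof -
  have "(\<Sum>\<theta>\<in>signs (insert a A). f \<theta>) = (\<Sum>(y, \<theta>)\<in>{-1, 1} \<times> signs A. f (\<theta>(a := y)))"
    unfolding PiE_insert_eq using inj_combinator[OF assms(2), of "\<lambda>_. {-1, 1::real}"]
    by (subst sum.reindex) (auto simp: case_prod_unfold)
  also have "\<dots> = (\<Sum>\<theta>\<in>signs A. f (\<theta>(a := 1)) + f (\<theta>(a := -1)))"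
    by (simp add: sum.distrib flip: sum.cartesian_product)
  finally show ?thesis
    using assms by (simp add: sign_mean_def sum_divide_distrib mult.commute)
qed

lemma sign_mean_mono: "(\<And>\<theta>. \<theta> \<in> signs A \<Longrightarrow> f \<theta> \<le> g \<theta>) \<Longrightarrow> sign_mean A f \<le> sign_mean A g"
  unfolding sign_mean_def by (intro divide_right_mono sum_mono) auto

lemma sign_mean_cong: "(\<And>\<theta>. \<theta> \<in> signs A \<Longrightarrow> f \<theta> = g \<theta>) \<Longrightarrow> sign_mean A f = sign_mean A g"
  unfolding sign_mean_def by (simp cong: sum.cong)

lemma sign_mean_add: "sign_mean A (\<lambda>\<theta>. f \<theta> + g \<theta>) = sign_mean A f + sign_mean A g"
  by (simp add: sign_mean_def sum.distrib add_divide_distrib)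

lemma sign_mean_cmult: "sign_mean A (\<lambda>\<theta>. c * f \<theta>) = c * sign_mean A f"
  by (simp add: sign_mean_def sum_distrib_left)

lemma sign_mean_const: "finite A \<Longrightarrow> sign_mean A (\<lambda>\<theta>. c) = c"
  by (simp add: sign_mean_def card_signs)

lemma sign_mean_sum: "sign_mean A (\<lambda>\<theta>. \<Sum>t\<in>T. f t \<theta>) = (\<Sum>t\<in>T. sign_mean A (f t))"
  unfolding sign_mean_def by (subst sum.swap) (simp add: sum_divide_distrib)

lemma sign_sum_insert:
  fixes x :: "'i \<Rightarrow> real"
  assumes "finite A" "a \<notin> A"
  shows "(\<Sum>i\<in>insert a A. (\<theta>(a := y)) i * x i) = y * x a + (\<Sum>i\<in>A. \<theta> i * x i)"
proof -
  have "(\<Sum>i\<in>A. (\<theta>(a := y)) i * x i) = (\<Sum>i\<in>A. \<theta> i * x i)"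
    using assms(2) by (intro sum.cong) auto
  then show ?thesis
    using assms by simp
qed

lemma sign_mean_square:
  assumes "finite A"
  shows "sign_mean A (\<lambda>\<theta>. (\<Sum>i\<in>A. \<theta> i * x i)\<^sup>2) = (\<Sum>i\<in>A. (x i)\<^sup>2)"
  using assms
proof (induction A)
  case (insert a A)
  have "sign_mean (insert a A) (\<lambda>\<theta>. (\<Sum>i\<in>insert a A. \<theta> i * x i)\<^sup>2)
      = sign_mean A (\<lambda>\<theta>. (x a)\<^sup>2 + (\<Sum>i\<in>A. \<theta> i * x i)\<^sup>2)"
    unfolding sign_mean_insert[OF insert(1,2)] sign_sum_insert[OF insert(1,2)]
    by (intro sign_mean_cong) algebra
  then show ?case
    using insert by (simp add: sign_mean_add sign_mean_const)
qed (simp add: sign_mean_empty)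

text \<open>Only even powers of a new sign survive the average, so \<open>\<langle>(S + \<epsilon> y)\<^sup>4\<rangle> = \<langle>S\<^sup>4\<rangle> + 6 y\<^sup>2 \<langle>S\<^sup>2\<rangle> + y\<^sup>4\<close>; the
  constant 3 is the Gaussian one and is reproduced by \<open>3 (\<sigma>\<^sup>2 + y\<^sup>2)\<^sup>2\<close>.\<close>

lemma sign_mean_fourth_power:
  assumes "finite A"
  shows "sign_mean A (\<lambda>\<theta>. (\<Sum>i\<in>A. \<theta> i * x i) ^ 4) \<le> 3 * (\<Sum>i\<in>A. (x i)\<^sup>2)\<^sup>2"
  using assms
proof (induction A)
  case (insert a A)
  have "sign_mean (insert a A) (\<lambda>\<theta>. (\<Sum>i\<in>insert a A. \<theta> i * x i) ^ 4)
      = sign_mean A (\<lambda>\<theta>. (x a) ^ 4 + (6 * (x a)\<^sup>2) * (\<Sum>i\<in>A. \<theta> i * x i)\<^sup>2 + (\<Sum>i\<in>A. \<theta> i * x i) ^ 4)"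
    unfolding sign_mean_insert[OF insert(1,2)] sign_sum_insert[OF insert(1,2)]
    by (intro sign_mean_cong) algebra
  also have "\<dots> \<le> (x a) ^ 4 + 6 * (x a)\<^sup>2 * (\<Sum>i\<in>A. (x i)\<^sup>2) + 3 * (\<Sum>i\<in>A. (x i)\<^sup>2)\<^sup>2"
    using insert by (simp add: sign_mean_add sign_mean_const sign_mean_cmult sign_mean_square)
  also have "\<dots> \<le> 3 * ((x a)\<^sup>2 + (\<Sum>i\<in>A. (x i)\<^sup>2))\<^sup>2"
  proof -
    have "3 * ((x a)\<^sup>2 + (\<Sum>i\<in>A. (x i)\<^sup>2))\<^sup>2 = (x a) ^ 4 + 6 * (x a)\<^sup>2 * (\<Sum>i\<in>A. (x i)\<^sup>2) + 3 * (\<Sum>i\<in>A. (x i)\<^sup>2)\<^sup>2 + 2 * (x a) ^ 4"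
      by algebra
    moreover have "0 \<le> 2 * (x a) ^ 4"
      by simp
    ultimately show ?thesis
      by linarith
  qed
  finally show ?case
    using insert by simp
qed (simp add: sign_mean_empty)

text \<open>The first moment is bounded below by the second and fourth through the pointwise inequality
  \<open>\<bar>u\<bar> \<ge> u\<^sup>2 - u\<^sup>4 / 6\<close>, applied to \<open>u = S / \<sigma>\<close> where \<open>\<langle>u\<^sup>2\<rangle> = 1\<close> and \<open>\<langle>u\<^sup>4\<rangle> \<le> 3\<close>. This avoids Hoelder's
  inequality; the constant \<open>1/2 = 1 - 3/6\<close> is not sharp.\<close>

lemma khintchine_L1:
  assumes "finite A"
  shows "sqrt (\<Sum>i\<in>A. (x i)\<^sup>2) / 2 \<le> sign_mean A (\<lambda>\<theta>. \<bar>\<Sum>i\<in>A. \<theta> i * x i\<bar>)"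
proof -
  define \<sigma> where "\<sigma> = sqrt (\<Sum>i\<in>A. (x i)\<^sup>2)"
  have sq: "\<sigma>\<^sup>2 = (\<Sum>i\<in>A. (x i)\<^sup>2)"
    unfolding \<sigma>_def by (simp add: sum_nonneg)
  show ?thesis
  proof (cases "\<sigma> > 0")
    case True
    have scalar: "u\<^sup>2 - u ^ 4 / 6 \<le> \<bar>u\<bar>" for u :: real
    proof -
      define v where "v = \<bar>u\<bar>"
      have "0 \<le> v * (6 - 6 * v + v ^ 3)"
      proof -
        \<comment> \<open>The cubic is minimal at \<open>v = sqrt 2\<close>; splitting off the double root leaves its minimal value.\<close>
        have "6 - 6 * v + v ^ 3 = (v + 2 * sqrt 2) * (v - sqrt 2)\<^sup>2 + (6 - 4 * sqrt 2)"
          using real_sqrt_pow2[of 2] by (simp add: algebra_simps power2_eq_square power3_eq_cube)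
        moreover have "4 * sqrt 2 \<le> 6"
          using real_le_lsqrt[of "3/2" 2] by (simp add: power2_eq_square)
        moreover have "0 \<le> (v + 2 * sqrt 2) * (v - sqrt 2)\<^sup>2"
          by (simp add: v_def)
        ultimately have "0 \<le> 6 - 6 * v + v ^ 3"
          by linarith
        then show ?thesis
          by (simp add: v_def)
      qed
      then have "v ^ 2 - v ^ 4 / 6 \<le> v"
        by (simp add: algebra_simps power2_eq_square power3_eq_cube power4_eq_xxxx)
      then show ?thesis
        by (simp add: v_def)
    qed
    have pointwise: "(1 / \<sigma>) * S\<^sup>2 + (- 1 / (6 * \<sigma> ^ 3)) * S ^ 4 \<le> \<bar>S\<bar>" for S
    proof -
      have "(1 / \<sigma>) * S\<^sup>2 + (- 1 / (6 * \<sigma> ^ 3)) * S ^ 4 = \<sigma> * ((S / \<sigma>)\<^sup>2 - (S / \<sigma>) ^ 4 / 6)"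
        using True by (simp add: field_simps eval_nat_numeral)
      also have "\<dots> \<le> \<sigma> * \<bar>S / \<sigma>\<bar>"
        using True by (intro mult_left_mono scalar) auto
      also have "\<dots> = \<bar>S\<bar>"
        using True by simp
      finally show ?thesis .
    qed
    have "\<sigma> / 2 = (1 / \<sigma>) * \<sigma>\<^sup>2 + (- 1 / (6 * \<sigma> ^ 3)) * (3 * (\<sigma>\<^sup>2)\<^sup>2)"
      using True by (simp add: field_simps power2_eq_square power3_eq_cube)
    also have "\<dots> \<le> (1 / \<sigma>) * sign_mean A (\<lambda>\<theta>. (\<Sum>i\<in>A. \<theta> i * x i)\<^sup>2)
        + (- 1 / (6 * \<sigma> ^ 3)) * sign_mean A (\<lambda>\<theta>. (\<Sum>i\<in>A. \<theta> i * x i) ^ 4)"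
      unfolding sq sign_mean_square[OF assms]
      by (intro add_left_mono mult_left_mono_neg sign_mean_fourth_power assms) (use True in auto)
    also have "\<dots> \<le> sign_mean A (\<lambda>\<theta>. \<bar>\<Sum>i\<in>A. \<theta> i * x i\<bar>)"
      unfolding sign_mean_cmult[symmetric] sign_mean_add[symmetric]
      by (intro sign_mean_mono pointwise)
    finally show ?thesis
      by (simp add: \<sigma>_def)
  next
    case False
    have "sign_mean A (\<lambda>_. 0) \<le> sign_mean A (\<lambda>\<theta>. \<bar>\<Sum>i\<in>A. \<theta> i * x i\<bar>)"
      by (intro sign_mean_mono) simp
    with False show ?thesis
      by (simp add: \<sigma>_def[symmetric] sign_mean_def[of A "\<lambda>_. 0"])
  qed
qed

text \<open>Signed sums are sub-Gaussian: the moment generating function factors into hyperbolic cosines.\<close>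

lemma sign_mean_exp_le:
  assumes "finite A"
  shows "sign_mean A (\<lambda>\<theta>. exp (\<Sum>i\<in>A. \<theta> i * x i)) \<le> exp ((\<Sum>i\<in>A. (x i)\<^sup>2) / 2)"
  using assms
proof (induction A)
  case (insert a A)
  have "sign_mean (insert a A) (\<lambda>\<theta>. exp (\<Sum>i\<in>insert a A. \<theta> i * x i))
      = sign_mean A (\<lambda>\<theta>. cosh (x a) * exp (\<Sum>i\<in>A. \<theta> i * x i))"
    unfolding sign_mean_insert[OF insert(1,2)] sign_sum_insert[OF insert(1,2)]
    by (intro sign_mean_cong) (simp add: exp_add exp_diff exp_minus cosh_field_def field_simps)
  also have "\<dots> \<le> exp ((x a)\<^sup>2 / 2) * exp ((\<Sum>i\<in>A. (x i)\<^sup>2) / 2)"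
    unfolding sign_mean_cmult
    by (intro mult_mono insert.IH cosh_le_exp_half_square)
      (auto simp: sign_mean_def intro!: sum_nonneg divide_nonneg_nonneg)
  finally show ?case
    using insert by (simp add: exp_add add_divide_distrib)
qed (simp add: sign_mean_empty)

text \<open>The maximal inequality by exponential moments. The parameter \<open>\<beta>\<close> is left free: the optimal choice
  would introduce \<open>sqrt (V * ln (card T))\<close>, while the application has an obvious near-optimal value.\<close>

lemma sign_mean_Max_le:
  assumes "finite A" "finite T" "T \<noteq> {}" "\<beta> > 0"
    and var: "\<And>t. t \<in> T \<Longrightarrow> (\<Sum>i\<in>A. (x t i)\<^sup>2) \<le> V"
  shows "sign_mean A (\<lambda>\<theta>. Max ((\<lambda>t. \<bar>\<Sum>i\<in>A. \<theta> i * x t i\<bar>) ` T))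
      \<le> ln (2 * card T) / \<beta> + \<beta> * V / 2"
proof -
  define Y where "Y = (\<lambda>\<theta> t. \<Sum>i\<in>A. \<theta> i * x t i)"
  define L where "L = ln (2 * card T) + \<beta>\<^sup>2 * V / 2"
  have cT: "card T > 0"
    using assms by (simp add: card_gt_0_iff)
  have expL: "exp L = 2 * card T * exp (\<beta>\<^sup>2 * V / 2)"
    using cT by (simp add: L_def exp_add)
  have mgf: "sign_mean A (\<lambda>\<theta>. exp (\<mu> * Y \<theta> t)) \<le> exp (\<beta>\<^sup>2 * V / 2)" if "t \<in> T" "\<mu>\<^sup>2 = \<beta>\<^sup>2" for t \<mu>
  proof -
    have "sign_mean A (\<lambda>\<theta>. exp (\<mu> * Y \<theta> t)) = sign_mean A (\<lambda>\<theta>. exp (\<Sum>i\<in>A. \<theta> i * (\<mu> * x t i)))"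
      by (simp add: Y_def sum_distrib_left mult_ac)
    also have "\<dots> \<le> exp ((\<Sum>i\<in>A. (\<mu> * x t i)\<^sup>2) / 2)"
      by (rule sign_mean_exp_le) fact
    also have "(\<Sum>i\<in>A. (\<mu> * x t i)\<^sup>2) = \<beta>\<^sup>2 * (\<Sum>i\<in>A. (x t i)\<^sup>2)"
      by (simp add: power_mult_distrib that sum_distrib_left)
    also have "exp (\<beta>\<^sup>2 * (\<Sum>i\<in>A. (x t i)\<^sup>2) / 2) \<le> exp (\<beta>\<^sup>2 * V / 2)"
      using var[OF that(1)] by (simp add: mult_left_mono)
    finally show ?thesis .
  qed
  have pointwise: "\<beta> * Max ((\<lambda>t. \<bar>Y \<theta> t\<bar>) ` T)
      \<le> (L - 1) + exp (- L) * (\<Sum>t\<in>T. exp (\<beta> * Y \<theta> t) + exp (- \<beta> * Y \<theta> t))" for \<theta>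
  proof -
    have "Max ((\<lambda>t. \<bar>Y \<theta> t\<bar>) ` T) \<in> (\<lambda>t. \<bar>Y \<theta> t\<bar>) ` T"
      using assms by (intro Max_in) auto
    then obtain t where t: "t \<in> T" "Max ((\<lambda>t. \<bar>Y \<theta> t\<bar>) ` T) = \<bar>Y \<theta> t\<bar>"
      by auto
    \<comment> \<open>The tangent of exp at \<open>0\<close>, used in place of Jensen's inequality; \<open>L\<close> is chosen so that the
      average of the exponential sum is at most \<open>exp L\<close>, and the bound then averages to \<open>L\<close>.\<close>
    have "\<beta> * \<bar>Y \<theta> t\<bar> \<le> (L - 1) + exp (\<beta> * \<bar>Y \<theta> t\<bar> - L)"
      using exp_ge_add_one_self[of "\<beta> * \<bar>Y \<theta> t\<bar> - L"] by linarith
    also have "exp (\<beta> * \<bar>Y \<theta> t\<bar> - L) = exp (- L) * exp (\<beta> * \<bar>Y \<theta> t\<bar>)"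
      by (simp flip: exp_add)
    also have "exp (\<beta> * \<bar>Y \<theta> t\<bar>) \<le> exp (\<beta> * Y \<theta> t) + exp (- \<beta> * Y \<theta> t)"
      by (cases "Y \<theta> t \<ge> 0") auto
    also have "\<dots> \<le> (\<Sum>t\<in>T. exp (\<beta> * Y \<theta> t) + exp (- \<beta> * Y \<theta> t))"
      by (intro member_le_sum[of t T] t assms) (auto intro: add_nonneg_nonneg)
    finally show ?thesis
      by (simp add: t)
  qed
  have "\<beta> * sign_mean A (\<lambda>\<theta>. Max ((\<lambda>t. \<bar>Y \<theta> t\<bar>) ` T))
      \<le> sign_mean A (\<lambda>\<theta>. (L - 1) + exp (- L) * (\<Sum>t\<in>T. exp (\<beta> * Y \<theta> t) + exp (- \<beta> * Y \<theta> t)))"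
    unfolding sign_mean_cmult[symmetric] by (intro sign_mean_mono pointwise)
  also have "\<dots> = (L - 1) + exp (- L) * (\<Sum>t\<in>T. sign_mean A (\<lambda>\<theta>. exp (\<beta> * Y \<theta> t))
      + sign_mean A (\<lambda>\<theta>. exp (- \<beta> * Y \<theta> t)))"
    using assms by (simp add: sign_mean_add sign_mean_cmult sign_mean_const sign_mean_sum)
  also have "\<dots> \<le> (L - 1) + exp (- L) * (\<Sum>t\<in>T. exp (\<beta>\<^sup>2 * V / 2) + exp (\<beta>\<^sup>2 * V / 2))"
    by (intro add_left_mono mult_left_mono sum_mono add_mono mgf) auto
  also have "\<dots> = (L - 1) + exp (- L) * exp L"
    by (simp add: expL)
  also have "\<dots> = L"
    by (simp flip: exp_add)
  finally have "\<beta> * sign_mean A (\<lambda>\<theta>. Max ((\<lambda>t. \<bar>Y \<theta> t\<bar>) ` T)) \<le> L" .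
  then have "sign_mean A (\<lambda>\<theta>. Max ((\<lambda>t. \<bar>Y \<theta> t\<bar>) ` T)) \<le> L / \<beta>"
    using assms by (simp add: field_simps)
  also have "\<dots> = ln (2 * card T) / \<beta> + \<beta> * V / 2"
    using assms by (simp add: L_def field_simps power2_eq_square)
  finally show ?thesis
    by (simp add: Y_def)
qed

section \<open>Lower bound: from the quadratic form to row norms\<close>

text \<open>Sign vectors are total functions here, so that flipping a sign or restricting attention to a
  subset of the indices needs no change of domain.\<close>

definition sign_function :: "('i \<Rightarrow> real) \<Rightarrow> bool" where
  "sign_function s \<longleftrightarrow> (\<forall>i. s i = 1 \<or> s i = -1)"

definition quad :: "('i \<Rightarrow> 'i \<Rightarrow> real) \<Rightarrow> 'i set \<Rightarrow> ('i \<Rightarrow> real) \<Rightarrow> real" where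
  "quad b A s = (\<Sum>i\<in>A. \<Sum>j\<in>A. b i j * s i * s j)"

definition row_norm :: "('i \<Rightarrow> 'i \<Rightarrow> real) \<Rightarrow> 'i set \<Rightarrow> 'i \<Rightarrow> real" where
  "row_norm b I i = sqrt (\<Sum>j\<in>I. (b i j)\<^sup>2)"

lemma row_norm_nonneg: "0 \<le> row_norm b I i"
  by (simp add: row_norm_def sum_nonneg)

lemma row_norm_square: "(row_norm b I i)\<^sup>2 = (\<Sum>j\<in>I. (b i j)\<^sup>2)"
  by (simp add: row_norm_def sum_nonneg)

lemma quad_insert:
  assumes "finite A" "x \<notin> A" and sym: "\<And>i j. b i j = b j i" and diag: "\<And>i. b i i = 0"
  shows "quad b (insert x A) s = quad b A s + 2 * s x * (\<Sum>j\<in>A. b x j * s j)"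
proof -
  have "quad b (insert x A) s = (\<Sum>j\<in>A. b x j * s x * s j) + ((\<Sum>i\<in>A. b i x * s i * s x) + quad b A s)"
    using assms(1,2) by (simp add: quad_def diag sum.distrib)
  also have "(\<Sum>i\<in>A. b i x * s i * s x) = (\<Sum>j\<in>A. b x j * s x * s j)"
    by (simp add: sym[of x] mult_ac)
  also have "(\<Sum>j\<in>A. b x j * s x * s j) = s x * (\<Sum>j\<in>A. b x j * s j)"
    by (simp add: sum_distrib_left mult_ac)
  finally show ?thesis
    by simp
qed

text \<open>The form on \<open>insert x A\<close> is affine in \<open>s x\<close> because the diagonal vanishes, so the form on \<open>A\<close> is the
  mean of its values at \<open>s x = 1\<close> and \<open>s x = -1\<close>.\<close>

lemma abs_quad_principal_minor_le:
  assumes "finite D" "finite A" "D \<inter> A = {}"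
    and sym: "\<And>i j. b i j = b j i" and diag: "\<And>i. b i i = 0"
    and bound: "\<And>s. sign_function s \<Longrightarrow> \<bar>quad b (D \<union> A) s\<bar> \<le> K"
    and "sign_function s"
  shows "\<bar>quad b A s\<bar> \<le> K"
  using assms(1,3,6,7)
proof (induction D arbitrary: s)
  case (insert x D)
  have "\<bar>quad b (D \<union> A) s\<bar> \<le> K" if s: "sign_function s" for s
  proof -
    have fresh: "finite (D \<union> A)" "x \<notin> D \<union> A"
      using insert.hyps insert.prems(1) assms(2) by auto
    let ?s = "s(x := - s x)"
    have "sign_function ?s"
      using s by (auto simp: sign_function_def)
    then have 1: "\<bar>quad b (insert x (D \<union> A)) ?s\<bar> \<le> K" and 2: "\<bar>quad b (insert x (D \<union> A)) s\<bar> \<le> K"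
      using insert.prems(2) s by auto
    have "quad b (D \<union> A) ?s = quad b (D \<union> A) s"
      unfolding quad_def using fresh by (intro sum.cong) auto
    moreover have "(\<Sum>j\<in>D \<union> A. b x j * ?s j) = (\<Sum>j\<in>D \<union> A. b x j * s j)"
      using fresh by (intro sum.cong) auto
    ultimately have "quad b (insert x (D \<union> A)) ?s
        = quad b (D \<union> A) s - 2 * s x * (\<Sum>j\<in>D \<union> A. b x j * s j)"
      using quad_insert[OF fresh, of b ?s] sym diag by simp
    with 1 2 quad_insert[OF fresh, of b s] sym diag show ?thesis
      by (simp add: abs_le_iff)
  qed
  with insert.IH insert.prems show ?case
    by blast
qed simp

text \<open>Decoupling. On the set where the two sign vectors agree the bilinear form is quadratic in \<open>s\<close>, on the
  set where they differ it is minus a quadratic form in \<open>s\<close>, and the two mixed parts have opposite signs and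
  cancel by symmetry.\<close>

lemma abs_bilinear_le:
  assumes "finite I" and sym: "\<And>i j. b i j = b j i" and diag: "\<And>i. b i i = 0"
    and bound: "\<And>s. sign_function s \<Longrightarrow> \<bar>quad b I s\<bar> \<le> K"
    and s: "sign_function s" and t: "sign_function t"
  shows "\<bar>\<Sum>i\<in>I. \<Sum>j\<in>I. b i j * s i * t j\<bar> \<le> 2 * K"
proof -
  define A where "A = {i \<in> I. t i = s i}"
  define B where "B = {i \<in> I. t i \<noteq> s i}"
  have I: "I = A \<union> B" "A \<inter> B = {}" "finite A" "finite B"
    using assms(1) by (auto simp: A_def B_def)
  have tA: "t j = s j" if "j \<in> A" for j
    using that by (simp add: A_def)
  have tB: "t j = - s j" if "j \<in> B" for j
    using that s t by (auto simp: B_def sign_function_def) (metis minus_minus)+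
  define cross where "cross = (\<Sum>i\<in>A. \<Sum>j\<in>B. b i j * s i * s j)"
  have cross: "(\<Sum>i\<in>B. \<Sum>j\<in>A. b i j * s i * s j) = cross"
    unfolding cross_def by (subst sum.swap) (simp add: sym mult_ac)
  have "(\<Sum>i\<in>I. \<Sum>j\<in>I. b i j * s i * t j)
      = (\<Sum>i\<in>I. (\<Sum>j\<in>A. b i j * s i * s j) - (\<Sum>j\<in>B. b i j * s i * s j))"
    unfolding I(1) using I(2-4)
    by (simp add: sum.union_disjoint tA tB sum_negf cong: sum.cong)
  also have "\<dots> = quad b A s - quad b B s"
    unfolding sum_subtractf unfolding I(1) sum.union_disjoint[OF I(3,4,2)] cross
    by (simp add: quad_def flip: cross_def)
  finally have eq: "(\<Sum>i\<in>I. \<Sum>j\<in>I. b i j * s i * t j) = quad b A s - quad b B s" .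
  have "\<bar>quad b A s\<bar> \<le> K"
    by (rule abs_quad_principal_minor_le[of B]) (use I sym diag bound s in \<open>auto simp: Un_commute\<close>)
  moreover have "\<bar>quad b B s\<bar> \<le> K"
    by (rule abs_quad_principal_minor_le[of A]) (use I sym diag bound s in auto)
  ultimately show ?thesis
    unfolding eq by linarith
qed

text \<open>For a given \<open>t\<close>, taking for \<open>s i\<close> the sign of \<open>\<Sum>\<^sub>j b i j t\<^sub>j\<close> turns the bilinear form into a sum
  of absolute values, to which Khintchine's inequality applies row by row.\<close>

lemma sum_row_norm_le:
  assumes "finite I" and sym: "\<And>i j. b i j = b j i" and diag: "\<And>i. b i i = 0"
    and bound: "\<And>s. sign_function s \<Longrightarrow> \<bar>quad b I s\<bar> \<le> K"
  shows "(\<Sum>i\<in>I. row_norm b I i) \<le> 4 * K"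
proof -
  have "(\<Sum>i\<in>I. row_norm b I i) / 2 = (\<Sum>i\<in>I. row_norm b I i / 2)"
    by (simp add: sum_divide_distrib)
  also have "\<dots> \<le> (\<Sum>i\<in>I. sign_mean I (\<lambda>\<theta>. \<bar>\<Sum>j\<in>I. \<theta> j * b i j\<bar>))"
    unfolding row_norm_def by (intro sum_mono khintchine_L1 assms)
  also have "\<dots> = sign_mean I (\<lambda>\<theta>. \<Sum>i\<in>I. \<bar>\<Sum>j\<in>I. \<theta> j * b i j\<bar>)"
    by (rule sign_mean_sum[symmetric])
  also have "\<dots> \<le> sign_mean I (\<lambda>\<theta>. 2 * K)"
  proof (rule sign_mean_mono)
    fix \<theta> :: "'a \<Rightarrow> real" assume \<theta>: "\<theta> \<in> signs I"
    define t where "t = (\<lambda>j. if j \<in> I then \<theta> j else 1)"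
    define s :: "'a \<Rightarrow> real" where "s = (\<lambda>i. if (\<Sum>j\<in>I. \<theta> j * b i j) \<ge> 0 then 1 else -1)"
    have "sign_function t" "sign_function s"
      using \<theta> by (auto simp: sign_function_def t_def s_def dest: PiE_mem)
    have "(\<Sum>i\<in>I. \<bar>\<Sum>j\<in>I. \<theta> j * b i j\<bar>) = (\<Sum>i\<in>I. s i * (\<Sum>j\<in>I. \<theta> j * b i j))"
      by (intro sum.cong) (auto simp: s_def)
    also have "\<dots> = (\<Sum>i\<in>I. \<Sum>j\<in>I. b i j * s i * t j)"
      unfolding sum_distrib_left by (intro sum.cong) (auto simp: t_def)
    also have "\<dots> \<le> 2 * K"
      using abs_bilinear_le[of I b K s t] assms \<open>sign_function t\<close> \<open>sign_function s\<close> by (auto simp: abs_le_iff)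
    finally show "(\<Sum>i\<in>I. \<bar>\<Sum>j\<in>I. \<theta> j * b i j\<bar>) \<le> 2 * K" .
  qed
  also have "\<dots> = 2 * K"
    using assms by (simp add: sign_mean_const)
  finally show ?thesis
    by simp
qed

section \<open>Upper bound: decomposition by the size of the row norms\<close>

definition chaos_on :: "('i \<Rightarrow> 'i \<Rightarrow> real) \<Rightarrow> ('i \<times> 'i) set \<Rightarrow> ('i \<times> 'i \<Rightarrow> real) \<Rightarrow> ('i \<Rightarrow> real) \<Rightarrow> real" where
  "chaos_on b Q \<theta> s = (\<Sum>(i, j)\<in>Q. \<theta> (i, j) * (b i j * s i * s j))"

text \<open>
  The contribution of one scale. The chaos over \<open>Q\<close> sees only the \<open>2 ^ card S\<close> sign patterns on \<open>S\<close>. Each pair in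
  \<open>Q\<close> has an index in \<open>D\<close>, where the rows have norm at most \<open>\<delta>\<close>, so its variance is at most
  \<open>2 * card S * \<delta>\<^sup>2\<close>. With \<open>\<beta> = 1 / \<delta>\<close> both terms of the maximal inequality are of order
  \<open>card S * \<delta>\<close>. The supremum over \<open>s\<close> enters as a function \<open>G\<close> that dominates the
  chaos, since bounds of this kind can be added over the scales.
\<close>

lemma dominating_block:
  fixes \<delta> :: real
  assumes "finite I" "P \<subseteq> I \<times> I" and S: "S \<subseteq> I" "S \<noteq> {}" and "D \<subseteq> S"
    and Q: "Q \<subseteq> P" "Q \<subseteq> D \<times> S \<union> S \<times> D"
    and sym: "\<And>i j. b i j = b j i"
    and small: "\<And>i. i \<in> D \<Longrightarrow> row_norm b I i \<le> \<delta>" and "\<delta> > 0"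
  shows "\<exists>G. (\<forall>\<theta> s. sign_function s \<longrightarrow> \<bar>chaos_on b Q \<theta> s\<bar> \<le> G \<theta>) \<and> sign_mean P G \<le> 3 * real (card S) * \<delta>"
proof -
  have fin: "finite P" "finite S" "finite D" "finite Q"
    using assms by (meson finite_subset finite_SigmaI)+
  define x where "x = (\<lambda>t p. if p \<in> Q then b (fst p) (snd p) * t (fst p) * t (snd p) else (0::real))"
  define G where "G = (\<lambda>\<theta>. Max ((\<lambda>t. \<bar>\<Sum>p\<in>P. \<theta> p * x t p\<bar>) ` signs S))"
  have chaos: "(\<Sum>p\<in>P. \<theta> p * x t p) = chaos_on b Q \<theta> t" for \<theta> t
  proof -
    have "(\<Sum>p\<in>P. \<theta> p * x t p) = (\<Sum>p\<in>Q. \<theta> p * x t p)"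
      using fin(1) Q(1) by (intro sum.mono_neutral_right) (auto simp: x_def)
    also have "\<dots> = chaos_on b Q \<theta> t"
      unfolding chaos_on_def by (intro sum.cong) (auto simp: x_def)
    finally show ?thesis .
  qed
  have dom: "\<bar>chaos_on b Q \<theta> s\<bar> \<le> G \<theta>" if "sign_function s" for \<theta> s
  proof -
    have "restrict s S \<in> signs S"
      using that by (auto simp: sign_function_def)
    moreover have "Q \<subseteq> S \<times> S"
      using Q(2) \<open>D \<subseteq> S\<close> by auto
    then have "chaos_on b Q \<theta> s = chaos_on b Q \<theta> (restrict s S)"
      unfolding chaos_on_def by (intro sum.cong) auto
    ultimately show ?thesis
      unfolding G_def chaos using finite_signs[OF fin(2)] by (auto intro!: Max_ge)
  qed
  have var: "(\<Sum>p\<in>P. (x t p)\<^sup>2) \<le> 2 * real (card S) * \<delta>\<^sup>2" if t: "t \<in> signs S" for t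
  proof -
    have half: "(\<Sum>(i, j)\<in>D \<times> S. (b i j)\<^sup>2) \<le> card S * \<delta>\<^sup>2"
    proof -
      have "(\<Sum>(i, j)\<in>D \<times> S. (b i j)\<^sup>2) = (\<Sum>i\<in>D. \<Sum>j\<in>S. (b i j)\<^sup>2)"
        by (simp add: sum.cartesian_product)
      also have "\<dots> \<le> (\<Sum>i\<in>D. (row_norm b I i)\<^sup>2)"
        unfolding row_norm_square using assms by (intro sum_mono sum_mono2) auto
      also have "\<dots> \<le> (\<Sum>i\<in>D. \<delta>\<^sup>2)"
        by (intro sum_mono power_mono small row_norm_nonneg)
      also have "\<dots> \<le> card S * \<delta>\<^sup>2"
        using card_mono[OF fin(2) \<open>D \<subseteq> S\<close>] by (simp add: mult_right_mono)
      finally show ?thesis .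
    qed
    have "(\<Sum>p\<in>P. (x t p)\<^sup>2) = (\<Sum>p\<in>Q. (x t p)\<^sup>2)"
      using fin(1) Q(1) by (intro sum.mono_neutral_right) (auto simp: x_def)
    also have "\<dots> = (\<Sum>(i, j)\<in>Q. (b i j)\<^sup>2)"
    proof (intro sum.cong refl)
      fix p assume "p \<in> Q"
      then have "p \<in> S \<times> S"
        using Q(2) \<open>D \<subseteq> S\<close> by blast
      then have "fst p \<in> S" "snd p \<in> S"
        by auto
      then have "\<bar>t (fst p)\<bar> = 1" "\<bar>t (snd p)\<bar> = 1"
        using t by (blast intro: abs_signs_eq_1)+
      then have "(t (fst p))\<^sup>2 = 1" "(t (snd p))\<^sup>2 = 1"
        by (metis power2_abs power_one)+
      with \<open>p \<in> Q\<close> show "(x t p)\<^sup>2 = (case p of (i, j) \<Rightarrow> (b i j)\<^sup>2)"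
        by (simp add: x_def power_mult_distrib case_prod_unfold)
    qed
    also have "\<dots> \<le> (\<Sum>(i, j)\<in>D \<times> S \<union> S \<times> D. (b i j)\<^sup>2)"
      using fin Q(2) by (intro sum_mono2) auto
    also have "\<dots> \<le> (\<Sum>(i, j)\<in>D \<times> S. (b i j)\<^sup>2) + (\<Sum>(i, j)\<in>S \<times> D. (b i j)\<^sup>2)"
    proof -
      have "0 \<le> (\<Sum>(i, j)\<in>D \<times> S \<inter> S \<times> D. (b i j)\<^sup>2)"
        by (intro sum_nonneg) auto
      then show ?thesis
        using fin by (subst sum_Un) auto
    qed
    also have "(\<Sum>(i, j)\<in>S \<times> D. (b i j)\<^sup>2) = (\<Sum>(i, j)\<in>D \<times> S. (b i j)\<^sup>2)"
      unfolding sum.cartesian_product[symmetric] by (subst sum.swap) (simp add: sym)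
    finally show ?thesis
      using half by simp
  qed
  have "sign_mean P G \<le> ln (2 * card (signs S)) / (1 / \<delta>) + (1 / \<delta>) * (2 * real (card S) * \<delta>\<^sup>2) / 2"
    unfolding G_def
    by (intro sign_mean_Max_le var fin finite_signs signs_nonempty) (use \<open>\<delta> > 0\<close> in auto)
  also have "\<dots> = ((real (card S) + 1) * ln 2 + real (card S)) * \<delta>"
  proof -
    have "ln (2 * card (signs S)) = (real (card S) + 1) * ln 2"
      using ln_realpow[of 2 "card S + 1"] by (simp add: card_signs fin)
    then show ?thesis
      using \<open>\<delta> > 0\<close> by (simp add: field_simps power2_eq_square)
  qed
  also have "\<dots> \<le> 3 * real (card S) * \<delta>"
  proof (rule mult_right_mono)
    have "real (card S) \<ge> 1"
      using S(2) fin(2) by (simp add: Suc_le_eq card_gt_0_iff)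
    then have "(real (card S) + 1) * ln 2 \<le> (2 * real (card S)) * 1"
      using ln_2_less_1 by (intro mult_mono) auto
    then show "(real (card S) + 1) * ln 2 + real (card S) \<le> 3 * real (card S)"
      by linarith
  qed (use \<open>\<delta> > 0\<close> in auto)
  finally show ?thesis
    using dom by blast
qed

text \<open>
  The cost of halving the threshold is paid by the potential
  \<open>\<Phi> d = \<Sum>\<^bsub>W\<^sub>i > d\<^esub> (2 W\<^sub>i - d)\<close>. In passing from \<open>d\<close> to \<open>d/2\<close> an old term
  grows by \<open>d/2\<close>, and a new term \<open>2 W\<^sub>i - d/2\<close> is at least \<open>d/2\<close> because \<open>W\<^sub>i > d/2\<close>; thus \<open>\<Phi>\<close> grows
  by at least \<open>card S\<^bsub>d/2\<^esub> * d/2\<close>, one sixth of the cost of the block. The factor 2 in \<open>2 W\<^sub>i\<close>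
  matters: with \<open>W\<^sub>i - d\<close> the new terms could be arbitrarily small.
\<close>

lemma halving_step:
  assumes "finite I" "P \<subseteq> I \<times> I" and sym: "\<And>i j. b i j = b j i" and "d > 0"
  defines "S \<equiv> \<lambda>d. {i \<in> I. row_norm b I i > d}"
  defines "\<Phi> \<equiv> \<lambda>d. \<Sum>i\<in>S d. 2 * row_norm b I i - d"
  assumes G: "\<And>\<theta> s. sign_function s \<Longrightarrow> \<bar>chaos_on b (P \<inter> S d \<times> S d) \<theta> s\<bar> \<le> G \<theta>"
    and mean: "sign_mean P G \<le> 6 * \<Phi> d"
  shows "\<exists>G. (\<forall>\<theta> s. sign_function s \<longrightarrow> \<bar>chaos_on b (P \<inter> S (d/2) \<times> S (d/2)) \<theta> s\<bar> \<le> G \<theta>)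
    \<and> sign_mean P G \<le> 6 * \<Phi> (d/2)"
proof (cases "S (d/2) = {}")
  case True
  then show ?thesis
    by (intro exI[of _ "\<lambda>_. 0"]) (simp add: chaos_on_def \<Phi>_def sign_mean_def)
next
  case False
  have fin: "finite (S e)" for e
    using assms(1) by (simp add: S_def)
  have finP: "finite P"
    using assms(1,2) by (meson finite_subset finite_SigmaI)
  have sub: "S d \<subseteq> S (d/2)"
    using \<open>d > 0\<close> by (auto simp: S_def)
  define R where "R = P \<inter> S (d/2) \<times> S (d/2) - P \<inter> S d \<times> S d"
  have "\<exists>H. (\<forall>\<theta> s. sign_function s \<longrightarrow> \<bar>chaos_on b R \<theta> s\<bar> \<le> H \<theta>)
      \<and> sign_mean P H \<le> 3 * real (card (S (d/2))) * d"
    by (rule dominating_block[where I = I and D = "S (d/2) - S d"])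
      (use False \<open>d > 0\<close> assms(1,2) sym in \<open>auto simp: R_def S_def\<close>)
  then obtain H where H: "\<And>\<theta> s. sign_function s \<Longrightarrow> \<bar>chaos_on b R \<theta> s\<bar> \<le> H \<theta>"
    and meanH: "sign_mean P H \<le> 3 * real (card (S (d/2))) * d"
    by blast
  have "\<bar>chaos_on b (P \<inter> S (d/2) \<times> S (d/2)) \<theta> s\<bar> \<le> G \<theta> + H \<theta>" if "sign_function s" for \<theta> s
  proof -
    have "chaos_on b (P \<inter> S (d/2) \<times> S (d/2)) \<theta> s
        = chaos_on b R \<theta> s + chaos_on b (P \<inter> S d \<times> S d) \<theta> s"
      unfolding chaos_on_def R_def
      by (intro sum.subset_diff) (use sub finP in auto)
    then show ?thesis
      using G[OF that, of \<theta>] H[OF that, of \<theta>] by linarith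
  qed
  moreover have "sign_mean P (\<lambda>\<theta>. G \<theta> + H \<theta>) \<le> 6 * \<Phi> (d/2)"
  proof -
    have "\<Phi> d + real (card (S (d/2))) * (d/2) = (\<Sum>i\<in>S d. 2 * row_norm b I i - d) + (\<Sum>i\<in>S (d/2). d/2)"
      by (simp add: \<Phi>_def)
    also have "\<dots> = (\<Sum>i\<in>S (d/2). (if i \<in> S d then 2 * row_norm b I i - d else 0) + d/2)"
      using sub fin[of "d/2"] by (simp add: sum.distrib sum.If_cases Int_absorb1)
    also have "\<dots> \<le> \<Phi> (d/2)"
      unfolding \<Phi>_def by (intro sum_mono) (auto simp: S_def)
    finally show ?thesis
      using mean meanH by (simp add: sign_mean_add)
  qed
  ultimately show ?thesis
    by (intro exI[of _ "\<lambda>\<theta>. G \<theta> + H \<theta>"]) blast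
qed

text \<open>The halving starts above all row norms, where no index is left, and stops below the
  smallest positive one; the remaining coefficients vanish.\<close>

lemma chaos_on_dominated:
  assumes "finite I" "P \<subseteq> I \<times> I" and sym: "\<And>i j. b i j = b j i"
  shows "\<exists>G. (\<forall>\<theta> s. sign_function s \<longrightarrow> \<bar>chaos_on b P \<theta> s\<bar> \<le> G \<theta>)
    \<and> sign_mean P G \<le> 12 * (\<Sum>i\<in>I. row_norm b I i)"
proof -
  define S where "S = (\<lambda>d. {i \<in> I. row_norm b I i > d})"
  define \<Phi> where "\<Phi> = (\<lambda>d. \<Sum>i\<in>S d. 2 * row_norm b I i - d)"
  \<comment> \<open>The summand 1 keeps the threshold positive when all coefficients are zero.\<close>
  define d\<^sub>0 where "d\<^sub>0 = 1 + (\<Sum>i\<in>I. row_norm b I i)"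
  have d0: "d\<^sub>0 > 0"
    unfolding d\<^sub>0_def by (intro add_pos_nonneg sum_nonneg row_norm_nonneg) auto
  have level: "\<exists>G. (\<forall>\<theta> s. sign_function s \<longrightarrow> \<bar>chaos_on b (P \<inter> S (d\<^sub>0 / 2 ^ k) \<times> S (d\<^sub>0 / 2 ^ k)) \<theta> s\<bar> \<le> G \<theta>)
    \<and> sign_mean P G \<le> 6 * \<Phi> (d\<^sub>0 / 2 ^ k)" for k
  proof (induction k)
    case 0
    have "row_norm b I i \<le> d\<^sub>0" if "i \<in> I" for i
    proof -
      have "row_norm b I i \<le> (\<Sum>i\<in>I. row_norm b I i)"
        using that assms(1) by (intro member_le_sum row_norm_nonneg) auto
      then show ?thesis
        by (simp add: d\<^sub>0_def)
    qed
    then have "S d\<^sub>0 = {}"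
      by (force simp: S_def)
    then show ?case
      by (intro exI[of _ "\<lambda>_. 0"]) (simp add: chaos_on_def \<Phi>_def sign_mean_def)
  next
    case (Suc k)
    then obtain G where G: "\<And>\<theta> s. sign_function s \<Longrightarrow> \<bar>chaos_on b (P \<inter> S (d\<^sub>0 / 2 ^ k) \<times> S (d\<^sub>0 / 2 ^ k)) \<theta> s\<bar> \<le> G \<theta>"
      "sign_mean P G \<le> 6 * \<Phi> (d\<^sub>0 / 2 ^ k)"
      by blast
    have "d\<^sub>0 / 2 ^ k > 0"
      using d0 by simp
    from halving_step[where G = G and d = "d\<^sub>0 / 2 ^ k", OF assms this] G show ?case
      by (simp add: S_def \<Phi>_def mult.commute)
  qed
  have "\<forall>\<^sub>F k in sequentially. \<forall>i\<in>I. row_norm b I i > 0 \<longrightarrow> d\<^sub>0 / 2 ^ k < row_norm b I i"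
  proof (rule eventually_ball_finite[OF assms(1)], rule ballI)
    fix i
    have lim: "(\<lambda>k. d\<^sub>0 / 2 ^ k) \<longlonglongrightarrow> 0"
      by (rule LIMSEQ_divide_realpow_zero) simp
    then show "\<forall>\<^sub>F k in sequentially. row_norm b I i > 0 \<longrightarrow> d\<^sub>0 / 2 ^ k < row_norm b I i"
      using order_tendstoD(2)[OF lim, of "row_norm b I i"] by (cases "row_norm b I i > 0") simp_all
  qed
  then obtain k where k: "\<And>i. i \<in> I \<Longrightarrow> row_norm b I i > 0 \<Longrightarrow> d\<^sub>0 / 2 ^ k < row_norm b I i"
    unfolding eventually_sequentially by blast
  define d where "d = d\<^sub>0 / 2 ^ k"
  have "d > 0"
    using d0 by (simp add: d_def)
  obtain G where G: "\<And>\<theta> s. sign_function s \<Longrightarrow> \<bar>chaos_on b (P \<inter> S d \<times> S d) \<theta> s\<bar> \<le> G \<theta>"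
    "sign_mean P G \<le> 6 * \<Phi> d"
    using level[of k] unfolding d_def by blast
  have zero: "b i j = 0" if "i \<in> I" "j \<in> I" "i \<notin> S d" for i j
  proof -
    have "row_norm b I i = 0"
      using k[of i] that row_norm_nonneg[of b I i] by (force simp: S_def d_def)
    then have "(\<Sum>j\<in>I. (b i j)\<^sup>2) = 0"
      using row_norm_square[of b I i] by simp
    then show ?thesis
      using that assms(1) by (simp add: sum_nonneg_eq_0_iff)
  qed
  have "chaos_on b P \<theta> s = chaos_on b (P \<inter> S d \<times> S d) \<theta> s" for \<theta> s
    unfolding chaos_on_def
  proof (intro sum.mono_neutral_right ballI)
    show "finite P"
      using assms by (meson finite_subset finite_SigmaI)
    fix p assume "p \<in> P - P \<inter> S d \<times> S d"
    then have "b (fst p) (snd p) = 0"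
      using zero[of "fst p" "snd p"] zero[of "snd p" "fst p"] assms(2) sym[of "fst p" "snd p"] by force
    then show "(case p of (i, j) \<Rightarrow> \<theta> (i, j) * (b i j * s i * s j)) = 0"
      by (simp add: case_prod_unfold)
  qed auto
  moreover have "6 * \<Phi> d \<le> 12 * (\<Sum>i\<in>I. row_norm b I i)"
  proof -
    have "\<Phi> d \<le> (\<Sum>i\<in>S d. 2 * row_norm b I i)"
      unfolding \<Phi>_def using \<open>d > 0\<close> by (intro sum_mono) auto
    also have "\<dots> \<le> (\<Sum>i\<in>I. 2 * row_norm b I i)"
      using assms(1) by (intro sum_mono2) (auto simp: S_def row_norm_nonneg)
    finally show ?thesis
      by (simp add: sum_distrib_left[symmetric])
  qed
  ultimately show ?thesis
    using G by (metis order_trans)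
qed

section \<open>The supremum norm as a maximum over signs\<close>

text \<open>The digits of \<open>m\<close> are built one at a time: halving the interval appends the digit that determines the
  next Rademacher function.\<close>

lemma exists_dyadic_interval_with_signs:
  assumes "sign_function s"
  shows "\<exists>m::nat. m < 2 ^ n \<and>
    (\<forall>t. real m \<le> 2 ^ n * t \<and> 2 ^ n * t < real m + 1 \<longrightarrow> (\<forall>i\<in>{1..n}. rademacher i t = s i))"
proof (induction n)
  case (Suc n)
  then obtain m :: nat where m: "m < 2 ^ n"
    "\<And>t i. real m \<le> 2 ^ n * t \<Longrightarrow> 2 ^ n * t < real m + 1 \<Longrightarrow> i \<in> {1..n} \<Longrightarrow> rademacher i t = s i"
    by blast
  define e :: nat where "e = (if s (Suc n) = 1 then 0 else 1)"
  have e: "e \<le> 1" "(-1) ^ e = s (Suc n)"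
    using assms by (auto simp: e_def sign_function_def)
  have "rademacher i t = s i"
    if t: "real (2 * m + e) \<le> 2 ^ Suc n * t" "2 ^ Suc n * t < real (2 * m + e) + 1" and i: "i \<in> {1..Suc n}" for t i
  proof (cases "i = Suc n")
    case True
    have "\<lfloor>2 ^ Suc n * t\<rfloor> = int (2 * m + e)"
      using t by (intro floor_unique) auto
    then show ?thesis
      by (simp only: rademacher_def True power_int_of_nat) (simp add: power_add power_mult e(2))
  next
    case False
    with i have "i \<in> {1..n}"
      by auto
    moreover have "real m \<le> 2 ^ n * t" "2 ^ n * t < real m + 1"
      using t e(1) by auto
    ultimately show ?thesis
      by (intro m(2))
  qed
  moreover have "2 * m + e < 2 ^ Suc n"
    using m(1) e(1) by simp
  ultimately show ?case
    by blast
qed auto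

definition sign_chaos :: "nat \<Rightarrow> (nat \<Rightarrow> nat \<Rightarrow> real) \<Rightarrow> (nat \<times> nat \<Rightarrow> real) \<Rightarrow> (nat \<Rightarrow> real) \<Rightarrow> real" where
  "sign_chaos n a \<theta> s = (\<Sum>i=1..n. \<Sum>j=i+1..n. \<theta> (i, j) * a i j * (s i * s j))"

lemma Linf_norm_le:
  assumes "\<And>s. sign_function s \<Longrightarrow> \<bar>sign_chaos n a \<theta> s\<bar> \<le> B"
  shows "Linf_norm (signed_chaos n a \<theta>) \<le> B"
proof -
  have "signed_chaos n a \<theta> \<in> borel_measurable borel"
    unfolding signed_chaos_def by measurable
  then have [measurable]: "signed_chaos n a \<theta> \<in> borel_measurable (lebesgue_on {0..1})"
    by (intro measurable_restrict_space1) (simp add: measurable_completion)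
  have "\<bar>signed_chaos n a \<theta> t\<bar> \<le> B" for t
  proof -
    have "rademacher i t = 1 \<or> rademacher i t = -1" for i
      using abs_rademacher[of i t] by linarith
    then have "sign_function (\<lambda>i. rademacher i t)"
      by (simp add: sign_function_def)
    from assms[OF this] show ?thesis
      by (simp add: sign_chaos_def signed_chaos_def)
  qed
  then have "esssup (lebesgue_on {0..1}) (\<lambda>t. ereal \<bar>signed_chaos n a \<theta> t\<bar>) \<le> ereal B"
    by (intro esssup_I) auto
  then show ?thesis
    by (simp flip: ereal_Linf_norm_chaos)
qed

text \<open>The essential supremum does not miss any sign pattern, since each one occupies an interval of positive
  length.\<close>

lemma abs_sign_chaos_le_Linf_norm:
  assumes "sign_function s"
  shows "\<bar>sign_chaos n a \<theta> s\<bar> \<le> Linf_norm (signed_chaos n a \<theta>)"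
proof (rule ccontr)
  assume contr: "\<not> ?thesis"
  obtain m :: nat where m: "m < 2 ^ n"
    "\<And>t i. real m \<le> 2 ^ n * t \<Longrightarrow> 2 ^ n * t < real m + 1 \<Longrightarrow> i \<in> {1..n} \<Longrightarrow> rademacher i t = s i"
    using exists_dyadic_interval_with_signs[OF assms, of n] by blast
  define J where "J = {real m / 2 ^ n <..< (real m + 1) / 2 ^ n}"
  have "real m + 1 \<le> 2 ^ n"
    using m(1) by (metis Suc_leI of_nat_Suc of_nat_le_iff of_nat_numeral of_nat_power add.commute)
  have J01: "t \<in> {0..1}" if "t \<in> J" for t
  proof -
    have "0 \<le> real m / 2 ^ n" "(real m + 1) / 2 ^ n \<le> 1"
      using \<open>real m + 1 \<le> 2 ^ n\<close> by auto
    then show ?thesis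
      using that unfolding J_def greaterThanLessThan_iff atLeastAtMost_iff by linarith
  qed
  have chaos: "signed_chaos n a \<theta> t = sign_chaos n a \<theta> s" if "t \<in> J" for t
  proof -
    have "rademacher i t = s i" if "i \<in> {1..n}" for i
      using m(2)[of t i] that \<open>t \<in> J\<close> by (simp add: J_def field_simps)
    then show ?thesis
      unfolding signed_chaos_def sign_chaos_def by (intro sum.cong) auto
  qed
  have "AE t in lebesgue_on {0..1}. ereal \<bar>signed_chaos n a \<theta> t\<bar> \<le> ereal (Linf_norm (signed_chaos n a \<theta>))"
    unfolding ereal_Linf_norm_chaos by (rule esssup_AE)
  then have "AE t in lebesgue. t \<in> {0..1} \<longrightarrow> \<bar>signed_chaos n a \<theta> t\<bar> \<le> Linf_norm (signed_chaos n a \<theta>)"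
    by (simp add: AE_restrict_space_iff)
  then have "AE t in lebesgue. t \<notin> J"
    by eventually_elim (use contr chaos J01 in auto)
  then have "J \<in> null_sets lebesgue"
    by (simp add: AE_iff_null_sets J_def)
  then have "emeasure lebesgue J = 0"
    by (rule null_setsD1)
  then have "emeasure lborel J = 0"
    by (simp add: J_def emeasure_completion)
  moreover have "emeasure lborel J = ennreal (1 / 2 ^ n)"
    unfolding J_def by (subst emeasure_lborel_Ioo) (auto simp: field_simps divide_right_mono simp flip: diff_divide_distrib)
  moreover have "ennreal (1 / 2 ^ n) > 0"
    unfolding ennreal_less_zero_iff by simp
  ultimately show False
    by simp
qed

section \<open>The two-sided estimate\<close>

definition symmetrize :: "(nat \<Rightarrow> nat \<Rightarrow> real) \<Rightarrow> nat \<Rightarrow> nat \<Rightarrow> real" where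
  "symmetrize x i j = (if i < j then x i j else if j < i then x j i else 0)"

lemma symmetrize_commute: "symmetrize x i j = symmetrize x j i"
  by (simp add: symmetrize_def)

lemma symmetrize_diag: "symmetrize x i i = 0"
  by (simp add: symmetrize_def)

lemma sum_off_diagonal:
  fixes f :: "nat \<Rightarrow> real"
  assumes "i \<in> {1..n}" "f i = 0"
  shows "(\<Sum>j=1..n. f j) = (\<Sum>j=i+1..n. f j) + (\<Sum>j=1..i-1. f j)"
proof -
  have "{1..n} = {i+1..n} \<union> ({1..i-1} \<union> {i})"
    using assms(1) by auto
  also have "sum f \<dots> = (\<Sum>j=i+1..n. f j) + ((\<Sum>j=1..i-1. f j) + f i)"
    using assms(1) by (subst sum.union_disjoint, (auto)[3], subst sum.union_disjoint) auto
  finally show ?thesis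
    using assms(2) by simp
qed

lemma sum_upper_triangle_swap:
  fixes f :: "nat \<Rightarrow> nat \<Rightarrow> real"
  shows "(\<Sum>i=1..n. \<Sum>j=1..i-1. f j i) = (\<Sum>i=1..n. \<Sum>j=i+1..n. f i j)"
proof -
  have "(\<Sum>i=1..n. \<Sum>j=1..i-1. f j i) = (\<Sum>i=1..n. \<Sum>j | j \<in> {1..n} \<and> j < i. f j i)"
    by (intro sum.cong) auto
  also have "\<dots> = (\<Sum>j=1..n. \<Sum>i | i \<in> {1..n} \<and> j < i. f j i)"
    by (rule sum.swap_restrict) auto
  also have "\<dots> = (\<Sum>i=1..n. \<Sum>j=i+1..n. f i j)"
    by (intro sum.cong) auto
  finally show ?thesis .
qed

lemma quad_symmetrize:
  "quad (symmetrize x) {1..n} s = 2 * (\<Sum>i=1..n. \<Sum>j=i+1..n. x i j * (s i * s j))"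
proof -
  have "quad (symmetrize x) {1..n} s
      = (\<Sum>i=1..n. (\<Sum>j=i+1..n. symmetrize x i j * s i * s j) + (\<Sum>j=1..i-1. symmetrize x i j * s i * s j))"
    unfolding quad_def by (intro sum.cong refl sum_off_diagonal) (auto simp: symmetrize_diag)
  also have "\<dots> = (\<Sum>i=1..n. \<Sum>j=i+1..n. x i j * (s i * s j)) + (\<Sum>i=1..n. \<Sum>j=1..i-1. x j i * (s j * s i))"
    unfolding sum.distrib by (intro arg_cong2[where f = "(+)"] sum.cong) (auto simp: symmetrize_def)
  also have "(\<Sum>i=1..n. \<Sum>j=1..i-1. x j i * (s j * s i)) = (\<Sum>i=1..n. \<Sum>j=i+1..n. x i j * (s i * s j))"
    by (rule sum_upper_triangle_swap)
  finally show ?thesis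
    by simp
qed


lemma row_norm_symmetrize:
  assumes "i \<in> {1..n}"
  shows "row_norm (symmetrize x) {1..n} i = sqrt ((\<Sum>j=i+1..n. (x i j)\<^sup>2) + (\<Sum>j=1..i-1. (x j i)\<^sup>2))"
proof -
  have "(\<Sum>j=1..n. (symmetrize x i j)\<^sup>2)
      = (\<Sum>j=i+1..n. (symmetrize x i j)\<^sup>2) + (\<Sum>j=1..i-1. (symmetrize x i j)\<^sup>2)"
    using assms by (intro sum_off_diagonal) (simp_all add: symmetrize_diag)
  also have "\<dots> = (\<Sum>j=i+1..n. (x i j)\<^sup>2) + (\<Sum>j=1..i-1. (x j i)\<^sup>2)"
    by (intro arg_cong2[where f = "(+)"] sum.cong) (auto simp: symmetrize_def)
  finally show ?thesis
    by (simp add: row_norm_def)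
qed

text \<open>The last row and the first column are empty, so both sums may run over the full index
  range.\<close>

lemma max_mixed_norm_alt:
  "max_mixed_norm n a = max (\<Sum>i=1..n. sqrt (\<Sum>j=i+1..n. (a i j)\<^sup>2)) (\<Sum>j=1..n. sqrt (\<Sum>i=1..j-1. (a i j)\<^sup>2))"
proof -
  have "(\<Sum>i=1..n-1. sqrt (\<Sum>j=i+1..n. (a i j)\<^sup>2)) = (\<Sum>i=1..n. sqrt (\<Sum>j=i+1..n. (a i j)\<^sup>2))"
    by (intro sum.mono_neutral_left) auto
  moreover have "(\<Sum>j=2..n. sqrt (\<Sum>i=1..j-1. (a i j)\<^sup>2)) = (\<Sum>j=1..n. sqrt (\<Sum>i=1..j-1. (a i j)\<^sup>2))"
  proof (intro sum.mono_neutral_left ballI)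
    fix j assume "j \<in> {1..n} - {2..n}"
    then have "j = 1"
      by auto
    then show "sqrt (\<Sum>i=1..j-1. (a i j)\<^sup>2) = 0"
      by simp
  qed auto
  ultimately show ?thesis
    by (simp only: max_mixed_norm_def)
qed

lemma max_mixed_norm_le_sum_row_norm:
  "max_mixed_norm n a \<le> (\<Sum>i=1..n. row_norm (symmetrize a) {1..n} i)"
proof -
  have "sqrt (\<Sum>j=i+1..n. (a i j)\<^sup>2) \<le> row_norm (symmetrize a) {1..n} i"
    "sqrt (\<Sum>j=1..i-1. (a j i)\<^sup>2) \<le> row_norm (symmetrize a) {1..n} i" if "i \<in> {1..n}" for i
    unfolding row_norm_symmetrize[OF that] by (simp_all add: sum_nonneg)
  then show ?thesis
    unfolding max_mixed_norm_alt by (intro max.boundedI sum_mono)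
qed

lemma sum_row_norm_le_max_mixed_norm:
  "(\<Sum>i=1..n. row_norm (symmetrize a) {1..n} i) \<le> 2 * max_mixed_norm n a"
proof -
  have "(\<Sum>i=1..n. row_norm (symmetrize a) {1..n} i)
      \<le> (\<Sum>i=1..n. sqrt (\<Sum>j=i+1..n. (a i j)\<^sup>2) + sqrt (\<Sum>j=1..i-1. (a j i)\<^sup>2))"
  proof (rule sum_mono)
    fix i assume "i \<in> {1..n}"
    then show "row_norm (symmetrize a) {1..n} i
        \<le> sqrt (\<Sum>j=i+1..n. (a i j)\<^sup>2) + sqrt (\<Sum>j=1..i-1. (a j i)\<^sup>2)"
      unfolding row_norm_symmetrize[OF \<open>i \<in> {1..n}\<close>] by (intro sqrt_add_le_add_sqrt sum_nonneg) auto
  qed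
  also have "\<dots> \<le> 2 * max_mixed_norm n a"
    unfolding max_mixed_norm_alt sum.distrib by simp
  finally show ?thesis .
qed

lemma sign_arrangements_eq: "sign_arrangements n = signs (index_pairs n)"
  by (simp add: sign_arrangements_def insert_commute)

lemma finite_index_pairs: "finite (index_pairs n)"
  by (rule finite_subset[of _ "{..n} \<times> {..n}"]) (auto simp: index_pairs_def)

lemma expected_norm_eq_sign_mean:
  "expected_norm n a = sign_mean (index_pairs n) (\<lambda>\<theta>. Linf_norm (signed_chaos n a \<theta>))"
  by (simp add: expected_norm_average sign_mean_def sign_arrangements_eq card_signs finite_index_pairs)

text \<open>Row norms do not see the signs \<open>\<theta>\<close>, so the lower bound is uniform in \<open>\<theta>\<close>.\<close>

lemma max_mixed_norm_le_Linf_norm: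
  assumes "\<theta> \<in> sign_arrangements n"
  shows "max_mixed_norm n a \<le> 8 * Linf_norm (signed_chaos n a \<theta>)"
proof -
  define x where "x = (\<lambda>i j. \<theta> (i, j) * a i j)"
  have sq: "(x i j)\<^sup>2 = (a i j)\<^sup>2" if "1 \<le> i" "i < j" "j \<le> n" for i j
  proof -
    have "\<bar>\<theta> (i, j)\<bar> = 1"
      using assms that unfolding sign_arrangements_eq
      by (rule_tac abs_signs_eq_1) (auto simp: index_pairs_def)
    then have "(\<theta> (i, j))\<^sup>2 = 1"
      by (metis power2_abs power_one)
    then show ?thesis
      by (simp add: x_def power_mult_distrib)
  qed
  have "row_norm (symmetrize x) {1..n} i = row_norm (symmetrize a) {1..n} i" if "i \<in> {1..n}" for i
  proof -
    have "(symmetrize x i j)\<^sup>2 = (symmetrize a i j)\<^sup>2" if "j \<in> {1..n}" for j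
      using that \<open>i \<in> {1..n}\<close> sq[of i j] sq[of j i] by (simp add: symmetrize_def)
    then show ?thesis
      unfolding row_norm_def by simp
  qed
  then have "max_mixed_norm n a \<le> (\<Sum>i=1..n. row_norm (symmetrize x) {1..n} i)"
    using max_mixed_norm_le_sum_row_norm[of n a] by simp
  also have "\<dots> \<le> 4 * (2 * Linf_norm (signed_chaos n a \<theta>))"
  proof (rule sum_row_norm_le)
    fix s :: "nat \<Rightarrow> real" assume "sign_function s"
    then have "\<bar>sign_chaos n a \<theta> s\<bar> \<le> Linf_norm (signed_chaos n a \<theta>)"
      by (rule abs_sign_chaos_le_Linf_norm)
    then show "\<bar>quad (symmetrize x) {1..n} s\<bar> \<le> 2 * Linf_norm (signed_chaos n a \<theta>)"
      unfolding quad_symmetrize sign_chaos_def x_def abs_mult by simp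
  qed (simp_all add: symmetrize_commute symmetrize_diag)
  finally show ?thesis
    by simp
qed

lemma sign_chaos_eq_chaos_on:
  "sign_chaos n a \<theta> s = chaos_on (symmetrize a) (index_pairs n) \<theta> s"
proof -
  have "index_pairs n = Sigma {1..n} (\<lambda>i. {i+1..n})"
    by (auto simp: index_pairs_def)
  then have "chaos_on (symmetrize a) (index_pairs n) \<theta> s
      = (\<Sum>i=1..n. \<Sum>j=i+1..n. \<theta> (i, j) * (symmetrize a i j * s i * s j))"
    unfolding chaos_on_def by (simp add: sum.Sigma)
  also have "\<dots> = sign_chaos n a \<theta> s"
    unfolding sign_chaos_def by (intro sum.cong) (auto simp: symmetrize_def)
  finally show ?thesis ..
qed

lemma expected_norm_le: "expected_norm n a \<le> 24 * max_mixed_norm n a"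
proof -
  have sub: "index_pairs n \<subseteq> {1..n} \<times> {1..n}"
    by (auto simp: index_pairs_def)
  obtain G where G: "\<And>\<theta> s. sign_function s \<Longrightarrow> \<bar>chaos_on (symmetrize a) (index_pairs n) \<theta> s\<bar> \<le> G \<theta>"
    and mean: "sign_mean (index_pairs n) G \<le> 12 * (\<Sum>i=1..n. row_norm (symmetrize a) {1..n} i)"
    using chaos_on_dominated[where b = "symmetrize a", OF finite_atLeastAtMost sub symmetrize_commute] by blast
  have "expected_norm n a \<le> sign_mean (index_pairs n) G"
    unfolding expected_norm_eq_sign_mean
    by (intro sign_mean_mono Linf_norm_le) (simp add: sign_chaos_eq_chaos_on G)
  then show ?thesis
    using mean sum_row_norm_le_max_mixed_norm[of a n] by linarith
qed

theorem theorem3: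
  "\<exists>c C :: real. 0 < c \<and> c \<le> C \<and>
     (\<forall>(n :: nat) (a :: nat \<Rightarrow> nat \<Rightarrow> real).
        c * max_mixed_norm n a \<le> expected_norm n a \<and> expected_norm n a \<le> C * max_mixed_norm n a \<and>
        c * max_mixed_norm n a \<le> min_norm n a \<and> min_norm n a \<le> C * max_mixed_norm n a)"
proof (rule exI[of _ "1/8"], rule exI[of _ 24], intro conjI allI)
  fix n :: nat and a :: "nat \<Rightarrow> nat \<Rightarrow> real"
  let ?norms = "(\<lambda>\<theta>. Linf_norm (signed_chaos n a \<theta>)) ` sign_arrangements n"
  have fin: "finite ?norms" "?norms \<noteq> {}"
    using finite_sign_arrangements sign_arrangements_nonempty by auto
  show lower: "1/8 * max_mixed_norm n a \<le> min_norm n a"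
  proof -
    have "1/8 * max_mixed_norm n a \<le> Linf_norm (signed_chaos n a \<theta>)" if "\<theta> \<in> sign_arrangements n" for \<theta>
      using max_mixed_norm_le_Linf_norm[OF that, of a] by simp
    then show ?thesis
      unfolding min_norm_def using fin by (intro Min.boundedI) auto
  qed
  have "sign_mean (index_pairs n) (\<lambda>_. min_norm n a) \<le> expected_norm n a"
    unfolding expected_norm_eq_sign_mean min_norm_def
    by (intro sign_mean_mono Min_le fin) (simp add: sign_arrangements_eq)
  then have min: "min_norm n a \<le> expected_norm n a"
    by (simp add: sign_mean_const finite_index_pairs)
  show "expected_norm n a \<le> 24 * max_mixed_norm n a"
    by (rule expected_norm_le)
  with min show "min_norm n a \<le> 24 * max_mixed_norm n a"
    by simp
  show "1/8 * max_mixed_norm n a \<le> expected_norm n a"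
    using lower min by simp
qed simp_all

end
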